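(* Consider an imprecise Markov chain with initial (marginal) model $\underline{E}_1$ and lower transition operator $\underline{\mathrm{T}}$. Assume that $\underline{\mathrm{T}}$ is Perron–Frobenius-like, with invariant lower expectation $\underline{E}_\infty$. Then for all $r\in\mathbb{N}$ and all $f\in\mathcal{G}(\mathcal{X}^r)$: $$\liminf_{n\to\infty}\frac1n\sum_{k=1}^{n}f(X_k,X_{k+1},\dots,X_{k+r-1})\geq\underline{E}_{\mathrm{st}}\big(f(X_1,\dots,X_r)\big)\quad\text{strictly almost surely}$$ (strictly almost surely with respect to the given imprecise Markov chain).
   Context: Write $\mathbb{N}=\{1,2,\dots\}$, $\mathbb{N}_0=\mathbb{N}\cup\{0\}$. Let $\mathcal{X}$ be a non-empty finite set (state space). A situation is a finite string $x_{1:n}=(x_1,\dots,x_n)\in\mathcal{X}^n$, $n\in\mathbb{N}_0$; the empty string is $\square$. A path is an element $\omega=(\omega_1,\omega_2,\dots)$ of $\Omega:=\mathcal{X}^{\mathbb{N}}$; $\omega^n:=(\omega_1,\dots,\omega_n)$; $X_k(\omega):=\omega_k$. Events are subsets of $\Omega$. A gamble on a set $Y$ is a bounded function $Y\to\mathbb{R}$; $\mathcal{G}(Y)$ is the set of these. A lower expectation on $\mathcal{G}(Y)$ is a functional $\underline{E}\colon\mathcal{G}(Y)\to\mathbb{R}$ with $\underline{E}(f)\geq\inf f$, $\underline{E}(f+g)\geq\underline{E}(f)+\underline{E}(g)$ and $\underline{E}(\lambda f)=\lambda\underline{E}(f)$ for all gambles $f,g$ and real $\lambda\geq0$; its conjugate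 is $\overline{E}(f):=-\underline{E}(-f)$. An imprecise probability tree attaches to each situation $x_{1:n}$ a lower expectation $\underline{Q}(\cdot|x_{1:n})$ on $\mathcal{G}(\mathcal{X})$, with conjugate $\overline{Q}(\cdot|x_{1:n})$. It is an imprecise Markov chain if $\underline{Q}(\cdot|x_{1:n})=\underline{Q}(\cdot|x_n)$ for all $n\in\mathbb{N}$ and $x_{1:n}\in\mathcal{X}^n$. Its marginal model is $\underline{E}_1:=\underline{Q}(\cdot|\square)$, and its lower transition operator $\underline{\mathrm{T}}\colon\mathcal{G}(\mathcal{X})\to\mathcal{G}(\mathcal{X})$ is $\underline{\mathrm{T}}f(x):=\underline{Q}(f|x)$. $\underline{\mathrm{T}}$ is Perron–Frobenius-like if for every $f\in\mathcal{G}(\mathcal{X})$ the sequence $\underline{\mathrm{T}}^nf$ converges point-wise to a constant real number, denoted $\underline{E}_\infty(f)$; $\underline{E}_\infty$ is then a lower expectation, and it is the only lower expectation on $\mathcal{G}(\mathcal{X})$ with $\underline{E}_\infty\circ\underline{\mathrm{T}}=\underline{E}_\infty$. A real process is a real-valued map $\mathcal{F}$ on situations; $\Delta\mathcal{F}(x_{1:n})(x_{n+1}):=\mathcal{F}(x_{1:n+1})-\mathcal{F}(x_{1:n})$. A submartingale is a real process $\mathcal{M}$ with $\underline{Q}(\Delta\mathcal{M}(s)|s)\geq0$ for all situations $s$; a supermartingale is a real process with $\overline{Q}(\Delta\mathcal{M}(s)|s)\leq0$ for all $s$. A test supermartingale is a non-negative supermartingale $\mathcal{T}$ with $\mathcal{T}(\square)=1$.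 An event $A$ is strictly null if some test supermartingale $\mathcal{T}$ satisfies $\lim_{n\to\infty}\mathcal{T}(\omega^n)=+\infty$ for all $\omega\in A$. A statement about paths holds strictly almost surely if the set of paths where it fails is strictly null. In any imprecise probability tree, the (unconditional) global lower expectation of a gamble $g$ on $\Omega$ is $\underline{E}(g):=\sup\{\mathcal{M}(\square):\mathcal{M}\text{ a submartingale with }\limsup_{n\to\infty}\mathcal{M}(\omega^n)\leq g(\omega)\text{ for all }\omega\in\Omega\}$. $\underline{E}_{\mathrm{st}}$ denotes this global lower expectation for the (stationary) imprecise Markov chain that has the same lower transition operator $\underline{\mathrm{T}}$ but marginal model $\underline{Q}(\cdot|\square):=\underline{E}_\infty$. *)

theory Defs
  imports "HOL-Analysis.Analysis"
begin

text \<open>The state space is a type of class \<open>finite\<close>, so every real function on it is a gamble.\<close>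

definition gamble :: "('y \<Rightarrow> real) \<Rightarrow> bool" where
  "gamble f \<longleftrightarrow> bounded (range f)"

definition lower_expectation :: "(('y \<Rightarrow> real) \<Rightarrow> real) \<Rightarrow> bool" where
  "lower_expectation E \<longleftrightarrow>
     (\<forall>f. gamble f \<longrightarrow> E f \<ge> (INF y. f y)) \<and>
     (\<forall>f g. gamble f \<longrightarrow> gamble g \<longrightarrow> E (\<lambda>y. f y + g y) \<ge> E f + E g) \<and>
     (\<forall>f c. gamble f \<longrightarrow> c \<ge> 0 \<longrightarrow> E (\<lambda>y. c * f y) = c * E f)"

definition conjugate :: "(('y \<Rightarrow> real) \<Rightarrow> real) \<Rightarrow> ('y \<Rightarrow> real) \<Rightarrow> real" where
  "conjugate E f = - E (\<lambda>y. - f y)"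

type_synonym 'a situation = "'a list"

text \<open>Paths are indexed from \<open>0\<close>: the first state of \<open>\<omega>\<close> is \<open>\<omega> 0\<close>.
  The variables \<open>X 1\<close>, \<open>X 2\<close>, \dots\ are indexed from \<open>1\<close>; \<open>X 0\<close> is not meaningful.\<close>

type_synonym 'a path = "nat \<Rightarrow> 'a"

definition X :: "nat \<Rightarrow> 'a path \<Rightarrow> 'a" where
  "X k \<omega> = \<omega> (k - 1)"

text \<open>\<open>Xs k r \<omega>\<close> is the tuple of the \<open>r\<close> states \<open>X k \<omega>\<close>, \dots, \<open>X (k + r - 1) \<omega>\<close>.\<close>

definition Xs :: "nat \<Rightarrow> nat \<Rightarrow> 'a path \<Rightarrow> 'a list" where
  "Xs k r \<omega> = map (\<lambda>i. X i \<omega>) [k..<k + r]"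

definition initial_segment :: "'a path \<Rightarrow> nat \<Rightarrow> 'a situation" where
  "initial_segment \<omega> n = Xs 1 n \<omega>"

type_synonym 'a tree = "'a situation \<Rightarrow> ('a \<Rightarrow> real) \<Rightarrow> real"

definition imprecise_probability_tree :: "'a::finite tree \<Rightarrow> bool" where
  "imprecise_probability_tree Q \<longleftrightarrow> (\<forall>s. lower_expectation (Q s))"

definition imprecise_Markov_chain :: "'a::finite tree \<Rightarrow> bool" where
  "imprecise_Markov_chain Q \<longleftrightarrow>
     imprecise_probability_tree Q \<and> (\<forall>s. s \<noteq> [] \<longrightarrow> Q s = Q [last s])"

definition marginal_model :: "'a::finite tree \<Rightarrow> ('a \<Rightarrow> real) \<Rightarrow> real" where
  "marginal_model Q = Q []"

definition lower_transition_operator :: "'a::finite tree \<Rightarrow> ('a \<Rightarrow> real) \<Rightarrow> ('a \<Rightarrow> real)" where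
  "lower_transition_operator Q f = (\<lambda>x. Q [x] f)"

definition Perron_Frobenius_like :: "(('a::finite \<Rightarrow> real) \<Rightarrow> ('a \<Rightarrow> real)) \<Rightarrow> bool" where
  "Perron_Frobenius_like T \<longleftrightarrow> (\<forall>f. \<exists>c. \<forall>x. (\<lambda>n. (T ^^ n) f x) \<longlonglongrightarrow> c)"

definition E_inf :: "(('a::finite \<Rightarrow> real) \<Rightarrow> ('a \<Rightarrow> real)) \<Rightarrow> ('a \<Rightarrow> real) \<Rightarrow> real" where
  "E_inf T f = (THE c. \<forall>x. (\<lambda>n. (T ^^ n) f x) \<longlonglongrightarrow> c)"

lemma E_inf_limit:
  assumes "Perron_Frobenius_like T"
  shows "(\<lambda>n. (T ^^ n) f x) \<longlonglongrightarrow> E_inf T f"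
proof -
  obtain c where c: "\<And>y. (\<lambda>n. (T ^^ n) f y) \<longlonglongrightarrow> c"
    using assms unfolding Perron_Frobenius_like_def by blast
  have "E_inf T f = c"
    unfolding E_inf_def
  proof (rule the_equality)
    show "\<forall>y. (\<lambda>n. (T ^^ n) f y) \<longlonglongrightarrow> c"
      using c by simp
    show "d = c" if "\<forall>y. (\<lambda>n. (T ^^ n) f y) \<longlonglongrightarrow> d" for d
      using LIMSEQ_unique[OF that[rule_format, of x] c[of x]] .
  qed
  then show ?thesis
    using c by simp
qed

type_synonym 'a process = "'a situation \<Rightarrow> real"

definition process_difference :: "'a process \<Rightarrow> 'a situation \<Rightarrow> 'a \<Rightarrow> real" where
  "process_difference M s x = M (s @ [x]) - M s"

definition submartingale :: "'a::finite tree \<Rightarrow> 'a process \<Rightarrow> bool" where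
  "submartingale Q M \<longleftrightarrow> (\<forall>s. Q s (process_difference M s) \<ge> 0)"

definition supermartingale :: "'a::finite tree \<Rightarrow> 'a process \<Rightarrow> bool" where
  "supermartingale Q M \<longleftrightarrow> (\<forall>s. conjugate (Q s) (process_difference M s) \<le> 0)"

definition test_supermartingale :: "'a::finite tree \<Rightarrow> 'a process \<Rightarrow> bool" where
  "test_supermartingale Q M \<longleftrightarrow> supermartingale Q M \<and> (\<forall>s. M s \<ge> 0) \<and> M [] = 1"

definition strictly_null :: "'a::finite tree \<Rightarrow> 'a path set \<Rightarrow> bool" where
  "strictly_null Q A \<longleftrightarrow>
     (\<exists>M. test_supermartingale Q M \<and>
       (\<forall>\<omega>\<in>A. filterlim (\<lambda>n. M (initial_segment \<omega> n)) at_top sequentially))"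

definition strictly_almost_surely :: "'a::finite tree \<Rightarrow> ('a path \<Rightarrow> bool) \<Rightarrow> bool" where
  "strictly_almost_surely Q P \<longleftrightarrow> strictly_null Q {\<omega>. \<not> P \<omega>}"

text \<open>The supremum is taken in the extended reals, where it always exists; it is finite
  when \<open>g\<close> is a gamble and \<open>Q\<close> an imprecise probability tree.\<close>

definition global_lower_expectation :: "'a::finite tree \<Rightarrow> ('a path \<Rightarrow> real) \<Rightarrow> ereal" where
  "global_lower_expectation Q g =
     Sup {ereal (M []) |M. submartingale Q M \<and>
       (\<forall>\<omega>. limsup (\<lambda>n. ereal (M (initial_segment \<omega> n))) \<le> ereal (g \<omega>))}"

definition stationary_chain :: "'a::finite tree \<Rightarrow> 'a tree" where
  "stationary_chain Q = Q([] := E_inf (lower_transition_operator Q))"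

end

theory Submission
  imports Defs
begin

text \<open>Write \<open>T\<close> for the lower transition operator, \<open>h x\<close> for the conditional lower expectation
  of \<open>f\<close> on the window of \<open>r\<close> states that starts in the state \<open>x\<close>, and \<open>c = E_inf T h\<close>.

  A submartingale has, from every situation, a path along which it never decreases. A submartingale
  whose limsup is bounded by \<open>f (X 1, \<dots>, X r)\<close> is therefore bounded by \<open>f\<close> at time \<open>r\<close>, and
  recursion back to the root gives at most \<open>c\<close> in the stationary chain, so \<open>c\<close> is an upper
  bound for the global lower expectation
  (\<open>global_lower_expectation_stationary_chain_le\<close>). It remains to bound the averages below by
  \<open>c\<close>.

  Given \<open>\<epsilon> > 0\<close>, choose \<open>m\<close> with \<open>T\<^sup>m h \<ge> c - \<epsilon>\<close>. This is possible because \<open>T\<^sup>m h\<close>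
  converges to \<open>c\<close> uniformly on the finite state space. Forecasting each window from the moment
  its first state lies \<open>m\<close> steps ahead, and summing the forecasts minus \<open>c - \<epsilon>\<close>, yields a
  submartingale with bounded increments. Up to a bounded error it is the sum of the observed
  values \<open>f (X k, \<dots>, X (k + r - 1))\<close> minus \<open>n (c - \<epsilon>)\<close> (\<open>strictly_null_average_below\<close>).

  A submartingale with bounded increments drops below \<open>- \<delta> n\<close> infinitely often only on a strictly
  null event (\<open>submartingale_strong_law\<close>): an exponential of it is a test supermartingale that is
  unbounded there, and a transform by the running maximum turns unboundedness into convergence to
  infinity (\<open>strictly_null_if_unbounded\<close>). The events for \<open>\<epsilon> = 1, 1/2, 1/3, \<dots>\<close> are combined
  by \<open>strictly_null_countable_UN\<close>.\<close>


section \<open>Lower expectations on a finite space\<close>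

lemma gamble_finite [simp]: "gamble (f :: 'a::finite \<Rightarrow> real)"
  by (simp add: gamble_def finite_imp_bounded)

context
  fixes E :: "('a::finite \<Rightarrow> real) \<Rightarrow> real"
  assumes E: "lower_expectation E"
begin

lemma lower_expectation_superadditive: "E f + E g \<le> E (\<lambda>y. f y + g y)"
  using E by (simp add: lower_expectation_def)

lemma lower_expectation_scale: "0 \<le> c \<Longrightarrow> E (\<lambda>y. c * f y) = c * E f"
  using E by (simp add: lower_expectation_def)

lemma lower_expectation_lower_bound:
  assumes "\<And>y. a \<le> f y"
  shows "a \<le> E f"
proof -
  have "a \<le> (INF y. f y)"
    by (rule cINF_greatest) (use assms in auto)
  also have "\<dots> \<le> E f"
    using E by (simp add: lower_expectation_def)
  finally show ?thesis .
qed

lemma lower_expectation_mono: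
  assumes "\<And>y. f y \<le> g y"
  shows "E f \<le> E g"
proof -
  have "0 \<le> E (\<lambda>y. g y - f y)"
    by (rule lower_expectation_lower_bound) (simp add: assms)
  then show ?thesis
    using lower_expectation_superadditive[of f "\<lambda>y. g y - f y"] by simp
qed

lemma lower_expectation_zero: "E (\<lambda>y. 0) = 0"
  using lower_expectation_scale[of 0 "\<lambda>y. 0"] by simp

lemma lower_expectation_const [simp]: "E (\<lambda>y. c) = c"
proof (rule antisym)
  have "- c \<le> E (\<lambda>y. - c)"
    by (rule lower_expectation_lower_bound) simp
  then show "E (\<lambda>y. c) \<le> c"
    using lower_expectation_superadditive[of "\<lambda>y. c" "\<lambda>y. - c"] lower_expectation_zero by simp
qed (simp add: lower_expectation_lower_bound)

lemma lower_expectation_upper_bound: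
  assumes "\<And>y. f y \<le> a"
  shows "E f \<le> a"
  using lower_expectation_mono[of f "\<lambda>y. a"] assms by simp

lemma lower_expectation_diff_const: "E (\<lambda>y. f y - c) = E f - c"
  using lower_expectation_superadditive[of f "\<lambda>y. - c"]
    lower_expectation_superadditive[of "\<lambda>y. f y - c" "\<lambda>y. c"]
  by simp

lemma lower_expectation_sum:
  assumes "finite J"
  shows "(\<Sum>j\<in>J. E (f j)) \<le> E (\<lambda>y. \<Sum>j\<in>J. f j y)"
  using assms
proof (induction rule: finite_induct)
  case (insert k J)
  then show ?case
    using lower_expectation_superadditive[of "f k" "\<lambda>y. \<Sum>j\<in>J. f j y"] by simp
qed simp

text \<open>On a finite space pointwise convergence is uniform, so non-negativity of a lower
  expectation survives pointwise limits.\<close>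

lemma lower_expectation_nonneg_limit:
  assumes lim: "\<And>y. (\<lambda>n. f n y) \<longlonglongrightarrow> g y" and nonneg: "\<And>n. 0 \<le> E (f n)"
  shows "0 \<le> E g"
proof -
  have "- (\<Sum>y\<in>UNIV. \<bar>g y - f n y\<bar>) \<le> E g" for n
  proof -
    have "- (\<Sum>y\<in>UNIV. \<bar>g y - f n y\<bar>) \<le> E (\<lambda>y. g y - f n y)"
    proof (rule lower_expectation_lower_bound)
      fix z
      have "\<bar>g z - f n z\<bar> \<le> (\<Sum>y\<in>UNIV. \<bar>g y - f n y\<bar>)"
        by (rule member_le_sum) auto
      then show "- (\<Sum>y\<in>UNIV. \<bar>g y - f n y\<bar>) \<le> g z - f n z" by linarith
    qed
    then show ?thesis
      using lower_expectation_superadditive[of "f n" "\<lambda>y. g y - f n y"] nonneg[of n] by simp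
  qed
  moreover have "(\<lambda>n. - (\<Sum>y\<in>UNIV. \<bar>g y - f n y\<bar>)) \<longlonglongrightarrow> - (\<Sum>y\<in>UNIV. \<bar>g y - g y\<bar>)"
    by (intro tendsto_intros lim)
  ultimately show ?thesis
    by (intro tendsto_upperbound[where f = "\<lambda>n. - (\<Sum>y\<in>UNIV. \<bar>g y - f n y\<bar>)"
          and F = sequentially]) auto
qed

end

lemma lower_expectation_finiteI:
  fixes E :: "('a::finite \<Rightarrow> real) \<Rightarrow> real"
  assumes "\<And>f a. (\<And>y. a \<le> f y) \<Longrightarrow> a \<le> E f"
    and "\<And>f g. E f + E g \<le> E (\<lambda>y. f y + g y)"
    and "\<And>f c. 0 \<le> c \<Longrightarrow> E (\<lambda>y. c * f y) = c * E f"
  shows "lower_expectation E"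
proof -
  have "(INF y. f y) \<le> E f" for f
    by (rule assms(1)) (simp add: cINF_lower)
  then show ?thesis
    using assms(2,3) by (simp add: lower_expectation_def)
qed

lemma lower_expectation_limit:
  fixes E :: "('a::finite \<Rightarrow> real) \<Rightarrow> real"
  assumes E: "\<And>n. lower_expectation (F n)" and lim: "\<And>f. (\<lambda>n. F n f) \<longlonglongrightarrow> E f"
  shows "lower_expectation E"
proof (rule lower_expectation_finiteI)
  show "a \<le> E f" if "\<And>y. a \<le> f y" for f a
    by (rule LIMSEQ_le_const[OF lim]) (use lower_expectation_lower_bound[OF E] that in blast)
  show "E f + E g \<le> E (\<lambda>y. f y + g y)" for f g
    by (rule LIMSEQ_le[OF tendsto_add[OF lim lim] lim])
      (use lower_expectation_superadditive[OF E] in blast)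
  show "E (\<lambda>y. c * f y) = c * E f" if "0 \<le> c" for f c
  proof (rule LIMSEQ_unique[OF lim])
    show "(\<lambda>n. F n (\<lambda>y. c * f y)) \<longlonglongrightarrow> c * E f"
      using tendsto_mult_left[OF lim] by (simp add: lower_expectation_scale[OF E that])
  qed
qed

lemma lower_expectation_iterate:
  fixes T :: "('a::finite \<Rightarrow> real) \<Rightarrow> ('a \<Rightarrow> real)"
  assumes T: "\<And>x. lower_expectation (\<lambda>f. T f x)"
  shows "lower_expectation (\<lambda>f. (T ^^ n) f x)"
proof (induction n arbitrary: x)
  case 0
  show ?case by (rule lower_expectation_finiteI) auto
next
  case (Suc n)
  show ?case
  proof (rule lower_expectation_finiteI)
    show "a \<le> (T ^^ Suc n) f x" if "\<And>y. a \<le> f y" for f a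
      using that by (auto intro!: lower_expectation_lower_bound[OF T]
          lower_expectation_lower_bound[OF Suc.IH])
    show "(T ^^ Suc n) f x + (T ^^ Suc n) g x \<le> (T ^^ Suc n) (\<lambda>y. f y + g y) x" for f g
    proof -
      have "T ((T ^^ n) f) x + T ((T ^^ n) g) x \<le> T (\<lambda>y. (T ^^ n) f y + (T ^^ n) g y) x"
        by (rule lower_expectation_superadditive[OF T])
      also have "\<dots> \<le> T ((T ^^ n) (\<lambda>y. f y + g y)) x"
        by (rule lower_expectation_mono[OF T] lower_expectation_superadditive[OF Suc.IH])+
      finally show ?thesis by simp
    qed
    show "(T ^^ Suc n) (\<lambda>y. c * f y) x = c * (T ^^ Suc n) f x" if c: "0 \<le> c" for f c
    proof -
      have "(T ^^ n) (\<lambda>y. c * f y) = (\<lambda>y. c * (T ^^ n) f y)"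
        by (rule ext) (rule lower_expectation_scale[OF Suc.IH c])
      then show ?thesis
        using lower_expectation_scale[OF T c] by simp
    qed
  qed
qed

lemma lower_expectation_E_inf:
  fixes T :: "('a::finite \<Rightarrow> real) \<Rightarrow> ('a \<Rightarrow> real)"
  assumes T: "\<And>x. lower_expectation (\<lambda>f. T f x)" and PF: "Perron_Frobenius_like T"
  shows "lower_expectation (E_inf T)"
  using lower_expectation_limit[of "\<lambda>n f. (T ^^ n) f undefined" "E_inf T"]
    lower_expectation_iterate[of T, OF T] E_inf_limit[OF PF]
  by blast


section \<open>Strictly null events\<close>

lemma Xs_Suc: "Xs (Suc k) r \<omega> = map \<omega> [k..<k + r]"
  by (simp add: Xs_def X_def list_eq_iff_nth_eq del: upt_Suc)

lemma initial_segment_eq_map: "initial_segment \<omega> n = map \<omega> [0..<n]"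
  by (simp add: initial_segment_def Xs_Suc)

lemma length_initial_segment [simp]: "length (initial_segment \<omega> n) = n"
  by (simp add: initial_segment_eq_map)

lemma take_initial_segment: "i \<le> n \<Longrightarrow> take i (initial_segment \<omega> n) = initial_segment \<omega> i"
  by (simp add: initial_segment_eq_map take_map)

lemma supermartingale_iff:
  "supermartingale Q M \<longleftrightarrow> (\<forall>s. 0 \<le> Q s (\<lambda>x. M s - M (s @ [x])))"
  by (simp add: supermartingale_def conjugate_def process_difference_def)

lemma submartingale_iff:
  "submartingale Q M \<longleftrightarrow> (\<forall>s. 0 \<le> Q s (\<lambda>x. M (s @ [x]) - M s))"
proof -
  have "process_difference M s = (\<lambda>x. M (s @ [x]) - M s)" for s
    by (simp add: process_difference_def fun_eq_iff)
  then show ?thesis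
    by (simp add: submartingale_def)
qed

lemma strictly_null_subset:
  "strictly_null Q B \<Longrightarrow> A \<subseteq> B \<Longrightarrow> strictly_null Q A"
  unfolding strictly_null_def by blast

text \<open>The running maximum of a process over the prefixes of a situation.\<close>

definition running_max :: "'a process \<Rightarrow> 'a process" where
  "running_max M s = Max ((\<lambda>i. M (take i s)) ` {..length s})"

lemma running_max_Nil [simp]: "running_max M [] = M []"
  by (simp add: running_max_def)

lemma running_max_snoc: "running_max M (s @ [x]) = max (running_max M s) (M (s @ [x]))"
proof -
  have "(\<lambda>i. M (take i (s @ [x]))) ` {..length (s @ [x])}
      = insert (M (s @ [x])) ((\<lambda>i. M (take i s)) ` {..length s})"
    by (auto simp: atMost_Suc image_iff)
  then show ?thesis
    by (simp add: running_max_def max.commute)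
qed

lemma running_max_ge: "i \<le> length s \<Longrightarrow> M (take i s) \<le> running_max M s"
  by (simp add: running_max_def)

text \<open>It is enough that a test supermartingale is unbounded along the paths of an event, although
  strict nullity asks for a limit. If \<open>R\<close> is the running maximum of \<open>M\<close>, then
  \<open>(sqrt R + M / sqrt R) / 2\<close> is again a test supermartingale: it is the Azema-Yor transform
  \<open>F R - F' R * (R - M)\<close> of \<open>M\<close> for the concave function \<open>F = sqrt\<close>. It dominates
  \<open>sqrt R / 2\<close>, which increases to infinity where \<open>M\<close> is unbounded.\<close>

lemma strictly_null_if_unbounded:
  fixes Q :: "'a::finite tree"
  assumes Q: "imprecise_probability_tree Q" and M: "test_supermartingale Q M"
    and unbounded: "\<And>\<omega> C. \<omega> \<in> A \<Longrightarrow> \<exists>n. C \<le> M (initial_segment \<omega> n)"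
  shows "strictly_null Q A"
proof -
  define R where "R = running_max M"
  define Y where "Y s = (sqrt (R s) + M s / sqrt (R s)) / 2" for s
  have E: "lower_expectation (Q s)" for s
    using Q by (simp add: imprecise_probability_tree_def)
  have M_nonneg: "0 \<le> M s" and M_Nil: "M [] = 1" for s
    using M by (auto simp: test_supermartingale_def)
  have R_ge_1: "1 \<le> R s" for s
    using running_max_ge[of 0 s M] by (simp add: R_def M_Nil)
  have Y_ge: "sqrt (R s) / 2 \<le> Y s" for s
    using R_ge_1[of s] M_nonneg[of s] by (simp add: Y_def)
  have step: "Y (s @ [x]) \<le> Y s + (M (s @ [x]) - M s) / (2 * sqrt (R s))" for s x
  proof -
    define a where "a = sqrt (R s)"
    have a: "0 < a" "R s = a\<^sup>2"
      using R_ge_1[of s] by (auto simp: a_def)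
    have bound: "Y s + (M (s @ [x]) - M s) / (2 * sqrt (R s)) = (a + M (s @ [x]) / a) / 2"
      using a(1) by (simp add: Y_def flip: a_def) (simp add: field_simps)
    show ?thesis
    proof (cases "M (s @ [x]) \<le> R s")
      case True
      then have "R (s @ [x]) = R s" by (simp add: R_def running_max_snoc)
      then show ?thesis
        using bound by (simp add: Y_def a_def)
    next
      case False
      define b where "b = sqrt (M (s @ [x]))"
      have b: "0 < b" "M (s @ [x]) = b\<^sup>2"
        using False R_ge_1[of s] by (auto simp: b_def)
      have "R (s @ [x]) = M (s @ [x])"
        using False by (simp add: R_def running_max_snoc)
      then have "Y (s @ [x]) = b"
        using b by (simp add: Y_def power2_eq_square)
      also have "b \<le> (a + b\<^sup>2 / a) / 2"
        using sum_squares_bound[of a b] a(1)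
        by (simp add: field_simps power2_eq_square)
      finally show ?thesis
        unfolding bound unfolding b(2) .
    qed
  qed
  have "supermartingale Q Y"
    unfolding supermartingale_iff
  proof
    fix s
    have "0 \<le> 1 / (2 * sqrt (R s)) * Q s (\<lambda>x. M s - M (s @ [x]))"
      using M R_ge_1[of s] by (simp add: test_supermartingale_def supermartingale_iff)
    also have "\<dots> = Q s (\<lambda>x. 1 / (2 * sqrt (R s)) * (M s - M (s @ [x])))"
      using R_ge_1[of s] by (intro lower_expectation_scale[OF E, symmetric]) simp
    also have "\<dots> \<le> Q s (\<lambda>x. Y s - Y (s @ [x]))"
    proof (rule lower_expectation_mono[OF E])
      fix x
      show "1 / (2 * sqrt (R s)) * (M s - M (s @ [x])) \<le> Y s - Y (s @ [x])"
        using step[of s x] by (simp add: diff_divide_distrib)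
    qed
    finally show "0 \<le> Q s (\<lambda>x. Y s - Y (s @ [x]))" .
  qed
  moreover have "0 \<le> Y s" for s
    using Y_ge[of s] R_ge_1[of s] by (meson divide_nonneg_nonneg order_trans real_sqrt_ge_zero
        zero_le_numeral zero_le_one)
  moreover have "Y [] = 1"
    by (simp add: Y_def R_def M_Nil)
  moreover have "filterlim (\<lambda>n. Y (initial_segment \<omega> n)) at_top sequentially" if \<omega>: "\<omega> \<in> A" for \<omega>
    unfolding filterlim_at_top
  proof
    fix C :: real
    obtain n0 where n0: "(2 * C)\<^sup>2 \<le> M (initial_segment \<omega> n0)"
      using unbounded[OF \<omega>] by blast
    have "C \<le> Y (initial_segment \<omega> n)" if "n \<ge> n0" for n
    proof -
      have "(2 * C)\<^sup>2 \<le> R (initial_segment \<omega> n)"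
        using n0 running_max_ge[of n0 "initial_segment \<omega> n" M] that
        by (simp add: R_def take_initial_segment)
      then have "2 * C \<le> sqrt (R (initial_segment \<omega> n))"
        by (rule real_le_rsqrt)
      then show ?thesis
        using Y_ge[of "initial_segment \<omega> n"] by simp
    qed
    then show "\<forall>\<^sub>F n in sequentially. C \<le> Y (initial_segment \<omega> n)"
      using eventually_at_top_linorder by blast
  qed
  ultimately show ?thesis
    unfolding strictly_null_def test_supermartingale_def by blast
qed

text \<open>A countable mixture of the witnessing test supermartingales \<open>M j\<close> works. The weight of
  \<open>M j\<close> is at most \<open>(1/2)^j\<close> divided by the maximum of \<open>M j\<close> over the finitely many
  situations of length at most \<open>j\<close>, so that the mixture converges in every situation.\<close>

lemma strictly_null_countable_UN:
  fixes Q :: "'a::finite tree" and A :: "nat \<Rightarrow> 'a path set"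
  assumes Q: "imprecise_probability_tree Q" and null: "\<And>j. strictly_null Q (A j)"
  shows "strictly_null Q (\<Union>j. A j)"
proof -
  have E: "lower_expectation (Q s)" for s
    using Q by (simp add: imprecise_probability_tree_def)
  obtain M where M: "\<And>j. test_supermartingale Q (M j)"
    and M_lim: "\<And>j \<omega>. \<omega> \<in> A j \<Longrightarrow>
      filterlim (\<lambda>n. M j (initial_segment \<omega> n)) at_top sequentially"
    using null unfolding strictly_null_def by metis
  have M_nonneg: "0 \<le> M j s" and M_Nil: "M j [] = 1" for j s
    using M by (auto simp: test_supermartingale_def)
  define S where "S j = (\<Sum>s | length s \<le> j. M j s)" for j
  have fin: "finite {s :: 'a list. length s \<le> j}" for j
    using finite_lists_length_le[of "UNIV :: 'a set" j] by simp
  have S_ge: "M j s \<le> S j" if "length s \<le> j" for j s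
    unfolding S_def by (rule member_le_sum) (use that fin M_nonneg in auto)
  have S_ge_1: "1 \<le> S j" for j
    using S_ge[of "[]" j] by (simp add: M_Nil)
  define w where "w j = (1/2) ^ j / S j" for j
  have w_pos: "0 < w j" for j
    using S_ge_1[of j] by (simp add: w_def)
  have summable: "summable (\<lambda>j. w j * M j s)" for s
  proof (rule summable_comparison_test)
    have "norm (w j * M j s) \<le> (1/2) ^ j" if "j \<ge> length s" for j
    proof -
      have "M j s / S j \<le> 1"
        using S_ge[OF that] S_ge_1[of j] by simp
      then have "(1/2) ^ j * (M j s / S j) \<le> (1/2) ^ j * 1"
        by (intro mult_left_mono) auto
      then show ?thesis
        using M_nonneg[of j s] S_ge_1[of j] by (simp add: w_def)
    qed
    then show "\<exists>N. \<forall>j\<ge>N. norm (w j * M j s) \<le> (1/2) ^ j" by blast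
    show "summable (\<lambda>j. (1/2 :: real) ^ j)"
      by (rule summable_geometric) simp
  qed
  define W where "W s = (\<Sum>j. w j * M j s)" for s
  have W_ge: "w j * M j s \<le> W s" for j s
    unfolding W_def using sum_le_suminf[OF summable, of "{j}" s] w_pos M_nonneg
    by (simp add: less_imp_le)
  have W_super: "0 \<le> Q s (\<lambda>x. W s - W (s @ [x]))" for s
  proof (rule lower_expectation_nonneg_limit[OF E])
    fix x
    have "(\<lambda>n. (\<Sum>j<n. w j * M j s) - (\<Sum>j<n. w j * M j (s @ [x]))) \<longlonglongrightarrow> W s - W (s @ [x])"
      unfolding W_def by (intro tendsto_diff summable_LIMSEQ summable)
    then show "(\<lambda>n. \<Sum>j<n. w j * (M j s - M j (s @ [x]))) \<longlonglongrightarrow> W s - W (s @ [x])"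
      by (simp add: right_diff_distrib sum_subtractf)
  next
    fix n
    have "0 \<le> Q s (\<lambda>x. w j * (M j s - M j (s @ [x])))" for j
      using M[of j] w_pos[of j] lower_expectation_scale[OF E, of "w j" s]
      by (simp add: test_supermartingale_def supermartingale_iff)
    then have "0 \<le> (\<Sum>j<n. Q s (\<lambda>x. w j * (M j s - M j (s @ [x]))))"
      by (intro sum_nonneg) auto
    also have "\<dots> \<le> Q s (\<lambda>x. \<Sum>j<n. w j * (M j s - M j (s @ [x])))"
      by (rule lower_expectation_sum[OF E]) simp
    finally show "0 \<le> Q s (\<lambda>x. \<Sum>j<n. w j * (M j s - M j (s @ [x])))" .
  qed
  define c where "c = 1 / W []"
  have c: "0 < c"
    using W_ge[of 0 "[]"] w_pos[of 0] by (simp add: c_def M_Nil)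
  have "test_supermartingale Q (\<lambda>s. c * W s)"
    unfolding test_supermartingale_def supermartingale_iff
  proof (intro conjI allI)
    show "0 \<le> Q s (\<lambda>x. c * W s - c * W (s @ [x]))" for s
      using lower_expectation_scale[OF E, of c s "\<lambda>x. W s - W (s @ [x])"] W_super[of s] c
      by (simp add: right_diff_distrib)
    show "0 \<le> c * W s" for s
      using W_ge[of 0 s] w_pos[of 0] M_nonneg[of 0 s] c
      by (meson less_imp_le mult_nonneg_nonneg order_trans)
    show "c * W [] = 1"
      using c by (simp add: c_def)
  qed
  moreover have "filterlim (\<lambda>n. c * W (initial_segment \<omega> n)) at_top sequentially"
    if "\<omega> \<in> A j" for \<omega> j
  proof (rule filterlim_at_top_mono)
    show "filterlim (\<lambda>n. (c * w j) * M j (initial_segment \<omega> n)) at_top sequentially"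
      by (rule filterlim_tendsto_pos_mult_at_top[OF tendsto_const _ M_lim[OF that]])
        (use c w_pos[of j] in simp)
    show "\<forall>\<^sub>F n in sequentially.
        (c * w j) * M j (initial_segment \<omega> n) \<le> c * W (initial_segment \<omega> n)"
      using W_ge c by (intro always_eventually) (simp add: mult.assoc)
  qed
  ultimately show ?thesis
    unfolding strictly_null_def by blast
qed


section \<open>A strong law of large numbers for submartingales\<close>

text \<open>For small \<open>\<eta>\<close>, \<open>exp (- \<eta> M - 2 n \<eta>\<^sup>2 B\<^sup>2)\<close> is a supermartingale, and it
  grows exponentially along the times \<open>n\<close> at which \<open>M\<close> has dropped by more than \<open>\<epsilon> n\<close>.\<close>

lemma submartingale_strong_law:
  fixes Q :: "'a::finite tree"
  assumes Q: "imprecise_probability_tree Q" and M: "submartingale Q M"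
    and bounded: "\<And>s x. \<bar>M (s @ [x]) - M s\<bar> \<le> B" and \<epsilon>: "\<epsilon> > 0"
  shows "strictly_null Q {\<omega>. \<exists>\<^sub>F n in sequentially. M (initial_segment \<omega> n) < M [] - \<epsilon> * real n}"
proof -
  have E: "lower_expectation (Q s)" for s
    using Q by (simp add: imprecise_probability_tree_def)
  define C where "C = max B 1"
  have C: "C \<ge> 1" and bounded': "\<bar>M (s @ [x]) - M s\<bar> \<le> C" for s x
    using bounded[of s x] by (auto simp: C_def)
  \<comment> \<open>The bound \<open>1 / (2 C)\<close> keeps \<open>\<eta>\<close> times an increment in the range of the quadratic
    estimate of the logarithm; the bound \<open>\<epsilon> / (4 C\<^sup>2)\<close> makes the quadratic loss at most half of
    the linear gain.\<close>
  define \<eta> where "\<eta> = min (\<epsilon> / (4 * C\<^sup>2)) (1 / (2 * C))"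
  have \<eta>: "0 < \<eta>" "\<eta> * C \<le> 1/2" "2 * \<eta> * C\<^sup>2 \<le> \<epsilon> / 2"
  proof -
    show "0 < \<eta>" using C \<epsilon> by (simp add: \<eta>_def)
    have "\<eta> \<le> 1 / (2 * C)" by (simp add: \<eta>_def)
    then show "\<eta> * C \<le> 1/2" using C by (simp add: field_simps)
    have "\<eta> \<le> \<epsilon> / (4 * C\<^sup>2)" by (simp add: \<eta>_def)
    then show "2 * \<eta> * C\<^sup>2 \<le> \<epsilon> / 2" using C by (simp add: field_simps)
  qed
  define S where "S s = exp (- \<eta> * (M s - M []) - 2 * \<eta>\<^sup>2 * C\<^sup>2 * real (length s))" for s
  have S_step: "S s * \<eta> * (M (s @ [x]) - M s) \<le> S s - S (s @ [x])" for s x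
  proof -
    define u where "u = \<eta> * (M (s @ [x]) - M s)"
    have u_abs: "\<bar>u\<bar> \<le> \<eta> * C"
      using bounded'[of s x] \<eta>(1) by (simp add: u_def abs_mult)
    then have u_half: "\<bar>- u\<bar> \<le> 1/2"
      using \<eta>(2) by linarith
    have u_sq: "u\<^sup>2 \<le> \<eta>\<^sup>2 * C\<^sup>2"
      using power_mono[OF u_abs, of 2] by (simp add: power_mult_distrib)
    have "\<bar>ln (1 + - u) - - u\<bar> \<le> 2 * (- u)\<^sup>2"
      by (rule abs_ln_one_plus_x_minus_x_bound[OF u_half])
    then have "- u - 2 * u\<^sup>2 \<le> ln (1 - u)"
      by (simp add: abs_le_iff)
    then have "- u - 2 * \<eta>\<^sup>2 * C\<^sup>2 \<le> ln (1 - u)"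
      using u_sq by linarith
    then have "exp (- u - 2 * \<eta>\<^sup>2 * C\<^sup>2) \<le> exp (ln (1 - u))"
      by simp
    also have "\<dots> = 1 - u"
      using u_half by (intro exp_ln) linarith
    finally have "S s * exp (- u - 2 * \<eta>\<^sup>2 * C\<^sup>2) \<le> S s * (1 - u)"
      by (intro mult_left_mono) (simp_all add: S_def)
    moreover have "S (s @ [x]) = S s * exp (- u - 2 * \<eta>\<^sup>2 * C\<^sup>2)"
      by (simp add: S_def u_def algebra_simps flip: exp_add)
    ultimately show ?thesis
      by (simp add: u_def algebra_simps)
  qed
  have "test_supermartingale Q S"
    unfolding test_supermartingale_def supermartingale_iff
  proof (intro conjI allI)
    fix s
    have "0 \<le> (S s * \<eta>) * Q s (\<lambda>x. M (s @ [x]) - M s)"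
      using M \<eta>(1) by (intro mult_nonneg_nonneg) (simp_all add: submartingale_iff S_def)
    also have "\<dots> = Q s (\<lambda>x. (S s * \<eta>) * (M (s @ [x]) - M s))"
      using \<eta>(1) by (intro lower_expectation_scale[OF E, symmetric]) (simp add: S_def)
    also have "\<dots> \<le> Q s (\<lambda>x. S s - S (s @ [x]))"
      by (rule lower_expectation_mono[OF E]) (rule S_step)
    finally show "0 \<le> Q s (\<lambda>x. S s - S (s @ [x]))" .
  qed (simp_all add: S_def)
  then show ?thesis
  proof (rule strictly_null_if_unbounded[OF Q])
    fix \<omega> K
    assume "\<omega> \<in> {\<omega>. \<exists>\<^sub>F n in sequentially. M (initial_segment \<omega> n) < M [] - \<epsilon> * real n}"
    then have freq: "\<exists>\<^sub>F n in sequentially. M (initial_segment \<omega> n) < M [] - \<epsilon> * real n"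
      by simp
    obtain N where N: "K < real N * (\<eta> * \<epsilon> / 2)"
      using ex_less_of_nat_mult[of "\<eta> * \<epsilon> / 2" K] \<eta>(1) \<epsilon> by auto
    obtain n where n: "n \<ge> N" "M (initial_segment \<omega> n) < M [] - \<epsilon> * real n"
      using freq by (auto simp: frequently_sequentially)
    have "K \<le> \<eta> * (\<epsilon> / 2) * real n"
    proof -
      have "real N * (\<eta> * \<epsilon> / 2) \<le> real n * (\<eta> * \<epsilon> / 2)"
        using n(1) \<eta>(1) \<epsilon> by (intro mult_right_mono) auto
      then show ?thesis using N by (simp add: mult_ac)
    qed
    also have "\<dots> \<le> \<eta> * (\<epsilon> - 2 * \<eta> * C\<^sup>2) * real n"
      using \<eta>(1,3) by (intro mult_right_mono mult_left_mono) auto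
    also have "\<dots> = \<eta> * (\<epsilon> * real n) - 2 * \<eta>\<^sup>2 * C\<^sup>2 * real n"
      by (simp add: algebra_simps power2_eq_square)
    also have "\<dots> \<le> \<eta> * (M [] - M (initial_segment \<omega> n)) - 2 * \<eta>\<^sup>2 * C\<^sup>2 * real n"
      using n(2) \<eta>(1) by (intro diff_right_mono mult_left_mono) auto
    also have "\<dots> = - \<eta> * (M (initial_segment \<omega> n) - M []) - 2 * \<eta>\<^sup>2 * C\<^sup>2 * real n"
      by (simp add: algebra_simps)
    also have "\<dots> \<le> S (initial_segment \<omega> n)"
      unfolding S_def length_initial_segment
      by (rule order_trans[OF _ exp_ge_add_one_self]) simp
    finally show "\<exists>n. K \<le> S (initial_segment \<omega> n)" by blast
  qed
qed


section \<open>Backward recursion and the stationary chain\<close>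

text \<open>\<open>iterated_lower Q g n s\<close> is the conditional lower expectation, given the situation \<open>s\<close>, of
  the gamble \<open>g\<close> on the situation reached after \<open>n\<close> further steps: the local models are applied
  backwards, starting from \<open>g\<close>.\<close>

primrec iterated_lower :: "'a::finite tree \<Rightarrow> ('a situation \<Rightarrow> real) \<Rightarrow> nat \<Rightarrow> 'a situation \<Rightarrow> real"
where
  "iterated_lower Q g 0 s = g s"
| "iterated_lower Q g (Suc n) s = Q s (\<lambda>x. iterated_lower Q g n (s @ [x]))"

lemma iterated_lower_abs_le:
  assumes Q: "imprecise_probability_tree Q"
    and g: "\<And>u. length u = n \<Longrightarrow> \<bar>g (s @ u)\<bar> \<le> C"
  shows "\<bar>iterated_lower Q g n s\<bar> \<le> C"
  using g
proof (induction n arbitrary: s)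
  case 0
  then show ?case using "0"[of "[]"] by simp
next
  case (Suc n)
  have E: "lower_expectation (Q s)"
    using Q by (simp add: imprecise_probability_tree_def)
  have "\<bar>iterated_lower Q g n (s @ [x])\<bar> \<le> C" for x
  proof (rule Suc.IH)
    show "\<bar>g ((s @ [x]) @ u)\<bar> \<le> C" if "length u = n" for u
      using Suc.prems[of "x # u"] that by simp
  qed
  then have "- C \<le> iterated_lower Q g n (s @ [x])" "iterated_lower Q g n (s @ [x]) \<le> C" for x
    by (simp_all add: abs_le_iff minus_le_iff)
  then have "- C \<le> iterated_lower Q g (Suc n) s" "iterated_lower Q g (Suc n) s \<le> C"
    by (simp_all add: lower_expectation_lower_bound[OF E] lower_expectation_upper_bound[OF E])
  then show ?case by linarith
qed

lemma iterated_lower_Markov: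
  assumes Q: "imprecise_Markov_chain Q"
    and "s \<noteq> []" "t \<noteq> []" "last s = last t"
    and g: "\<And>u. length u = n \<Longrightarrow> g (s @ u) = g' (t @ u)"
  shows "iterated_lower Q g n s = iterated_lower Q g' n t"
  using assms(2-)
proof (induction n arbitrary: s t)
  case 0
  then show ?case using "0.prems"(4)[of "[]"] by simp
next
  case (Suc n)
  have "Q s = Q t"
    using Q Suc.prems by (metis imprecise_Markov_chain_def)
  moreover have "iterated_lower Q g n (s @ [x]) = iterated_lower Q g' n (t @ [x])" for x
  proof (rule Suc.IH)
    show "g ((s @ [x]) @ u) = g' ((t @ [x]) @ u)" if "length u = n" for u
      using Suc.prems(4)[of "x # u"] that by simp
  qed simp_all
  ultimately show ?case by simp
qed

lemma iterated_lower_change_marginal: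
  "s \<noteq> [] \<Longrightarrow> iterated_lower (Q([] := F)) g n s = iterated_lower Q g n s"
  by (induction n arbitrary: s) simp_all

text \<open>As a local lower expectation never exceeds the maximum, the state space always offers a next
  state in which a submartingale has not decreased.\<close>

lemma submartingale_nondecreasing_path:
  fixes Q :: "'a::finite tree"
  assumes Q: "imprecise_probability_tree Q" and M: "submartingale Q M"
  obtains \<omega> where "initial_segment \<omega> (length s) = s"
    and "\<And>n. M s \<le> M (initial_segment \<omega> (length s + n))"
proof -
  have "\<exists>x. M t \<le> M (t @ [x])" for t
  proof (rule ccontr)
    assume "\<not> ?thesis"
    then have neg: "process_difference M t x < 0" for x
      by (simp add: process_difference_def not_le)
    have E: "lower_expectation (Q t)"
      using Q by (simp add: imprecise_probability_tree_def)
    have "Q t (process_difference M t) \<le> Max (range (process_difference M t))"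
      by (rule lower_expectation_upper_bound[OF E]) simp
    also have "\<dots> < 0"
      using neg by (subst Max_less_iff) auto
    finally show False
      using M by (simp add: submartingale_def not_le[symmetric])
  qed
  then obtain y where y: "\<And>t. M t \<le> M (t @ [y t])" by metis
  define P where "P n = ((\<lambda>t. t @ [y t]) ^^ n) s" for n
  have P_0: "P 0 = s" and P_Suc: "P (Suc n) = P n @ [y (P n)]" for n
    by (simp_all add: P_def)
  have length_P: "length (P n) = length s + n" for n
    by (induction n) (simp_all add: P_0 P_Suc)
  have take_P_add: "take (length s + n) (P (n + k)) = P n" for n k
    by (induction k) (simp_all add: P_Suc length_P)
  have take_P: "take (length s + n) (P k) = P n" if "n \<le> k" for n k
    using take_P_add[of n "k - n"] that by simp
  define \<omega> where "\<omega> i = P (Suc i) ! i" for i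
  have segment: "initial_segment \<omega> (length s + n) = P n" for n
  proof (rule nth_equalityI)
    fix i
    assume "i < length (initial_segment \<omega> (length s + n))"
    then have i: "i < length s + n" by simp
    have "P (Suc i) ! i = P n ! i"
    proof (cases "Suc i \<le> n")
      case True
      then show ?thesis
        using take_P[OF True] nth_take[of i "length s + Suc i" "P n"] by simp
    next
      case False
      then show ?thesis
        using take_P[of n "Suc i"] nth_take[of i "length s + n" "P (Suc i)"] i by simp
    qed
    then show "initial_segment \<omega> (length s + n) ! i = P n ! i"
      using i by (simp add: initial_segment_eq_map \<omega>_def)
  qed (simp add: length_P)
  show thesis
  proof
    show "initial_segment \<omega> (length s) = s"
      using segment[of 0] by (simp add: P_0)
    show "M s \<le> M (initial_segment \<omega> (length s + n))" for n
      unfolding segment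
    proof (induction n)
      case (Suc n)
      then show ?case using y[of "P n"] by (simp add: P_Suc)
    qed (simp add: P_0)
  qed
qed

text \<open>A submartingale with limsup at most \<open>f\<close> is at most \<open>f\<close> at time \<open>r\<close> already, since
  otherwise it would exceed \<open>f\<close> along a path on which it does not decrease. Backward recursion
  carries the bound to the root.\<close>

lemma global_lower_expectation_le_iterated_lower:
  fixes Q :: "'a::finite tree"
  assumes Q: "imprecise_probability_tree Q"
  shows "global_lower_expectation Q (\<lambda>\<omega>. f (Xs 1 r \<omega>)) \<le> ereal (iterated_lower Q f r [])"
  unfolding global_lower_expectation_def
proof (rule Sup_least, clarify)
  fix M
  assume M: "submartingale Q M"
    and limsup: "\<forall>\<omega>. limsup (\<lambda>n. ereal (M (initial_segment \<omega> n))) \<le> ereal (f (Xs 1 r \<omega>))"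
  have "M s \<le> iterated_lower Q f n s" if "length s + n = r" for n s
    using that
  proof (induction n arbitrary: s)
    case 0
    obtain \<omega> where \<omega>: "initial_segment \<omega> (length s) = s"
      and mono: "\<And>n. M s \<le> M (initial_segment \<omega> (length s + n))"
      using submartingale_nondecreasing_path[OF Q M] by blast
    have "M s \<le> M (initial_segment \<omega> n)" if "n \<ge> length s" for n
      using mono[of "n - length s"] that by simp
    then have "ereal (M s) \<le> limsup (\<lambda>n. ereal (M (initial_segment \<omega> n)))"
      by (intro le_Limsup) (auto simp: eventually_sequentially)
    also have "\<dots> \<le> ereal (f (Xs 1 r \<omega>))"
      using limsup by blast
    also have "Xs 1 r \<omega> = s"
      using \<omega> "0" by (simp add: initial_segment_def)
    finally show ?case by simp
  next
    case (Suc n)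
    have E: "lower_expectation (Q s)"
      using Q by (simp add: imprecise_probability_tree_def)
    have "0 \<le> Q s (\<lambda>x. M (s @ [x]) - M s)"
      using M by (simp add: submartingale_iff)
    then have "M s \<le> Q s (\<lambda>x. M (s @ [x]))"
      by (simp add: lower_expectation_diff_const[OF E])
    also have "\<dots> \<le> Q s (\<lambda>x. iterated_lower Q f n (s @ [x]))"
      by (rule lower_expectation_mono[OF E]) (use Suc in simp)
    finally show ?case by simp
  qed
  from this[of "[]" r] show "ereal (M []) \<le> ereal (iterated_lower Q f r [])" by simp
qed

lemma imprecise_Markov_chain_tree: "imprecise_Markov_chain Q \<Longrightarrow> imprecise_probability_tree Q"
  unfolding imprecise_Markov_chain_def by blast

lemma lower_expectation_lower_transition_operator:
  "imprecise_Markov_chain Q \<Longrightarrow> lower_expectation (\<lambda>f. lower_transition_operator Q f x)"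
  using imprecise_Markov_chain_tree[of Q]
  by (simp add: imprecise_probability_tree_def lower_transition_operator_def)

lemma global_lower_expectation_stationary_chain_le:
  fixes Q :: "'a::finite tree"
  assumes Q: "imprecise_Markov_chain Q"
    and PF: "Perron_Frobenius_like (lower_transition_operator Q)"
    and r: "r \<ge> 1"
  shows "global_lower_expectation (stationary_chain Q) (\<lambda>\<omega>. f (Xs 1 r \<omega>))
    \<le> ereal (E_inf (lower_transition_operator Q) (\<lambda>x. iterated_lower Q f (r - 1) [x]))"
proof -
  have "lower_expectation (E_inf (lower_transition_operator Q))"
    by (rule lower_expectation_E_inf[OF lower_expectation_lower_transition_operator[OF Q] PF])
  then have "imprecise_probability_tree (stationary_chain Q)"
    using imprecise_Markov_chain_tree[OF Q]
    by (simp add: imprecise_probability_tree_def stationary_chain_def)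
  then have "global_lower_expectation (stationary_chain Q) (\<lambda>\<omega>. f (Xs 1 r \<omega>))
      \<le> ereal (iterated_lower (stationary_chain Q) f r [])"
    by (rule global_lower_expectation_le_iterated_lower)
  also have "iterated_lower (stationary_chain Q) f r []
      = E_inf (lower_transition_operator Q) (\<lambda>x. iterated_lower Q f (r - 1) [x])"
    using r by (cases r) (simp_all add: stationary_chain_def iterated_lower_change_marginal)
  finally show ?thesis .
qed


section \<open>Time averages over windows\<close>

text \<open>The conditional lower expectation given \<open>s\<close> of \<open>f\<close> applied to the window of \<open>r\<close> states
  that starts after the first \<open>k\<close> states. The number of remaining steps is a truncated difference:
  it is \<open>0\<close> once \<open>s\<close> contains the whole window.\<close>

definition window_forecast ::
  "'a::finite tree \<Rightarrow> ('a list \<Rightarrow> real) \<Rightarrow> nat \<Rightarrow> nat \<Rightarrow> 'a process" where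
  "window_forecast Q f r k s =
     iterated_lower Q (\<lambda>t. f (take r (drop k t))) (k + r - length s) s"

lemma window_forecast_observed:
  "k + r \<le> length s \<Longrightarrow> window_forecast Q f r k s = f (take r (drop k s))"
  by (simp add: window_forecast_def)

lemma window_forecast_step:
  assumes Q: "imprecise_probability_tree Q"
  shows "Q s (\<lambda>x. window_forecast Q f r k (s @ [x])) = window_forecast Q f r k s"
proof (cases "length s < k + r")
  case True
  then have "k + r - length s = Suc (k + r - length (s @ [x]))" for x
    by simp
  then show ?thesis
    by (simp add: window_forecast_def)
next
  case False
  have "lower_expectation (Q s)"
    using Q by (simp add: imprecise_probability_tree_def)
  with False show ?thesis
    by (simp add: window_forecast_observed)
qed

lemma window_forecast_abs_le:
  assumes Q: "imprecise_probability_tree Q" and f: "\<And>t. length t = r \<Longrightarrow> \<bar>f t\<bar> \<le> C"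
  shows "\<bar>window_forecast Q f r k s\<bar> \<le> C"
  unfolding window_forecast_def
  by (rule iterated_lower_abs_le[OF Q]) (auto intro!: f)

text \<open>At the first state \<open>x\<close> of its window the forecast is \<open>h x = iterated_lower Q f (r - 1) [x]\<close>,
  by the Markov property; each earlier step applies the lower transition operator once more.\<close>

lemma window_forecast_early:
  assumes Q: "imprecise_Markov_chain Q" and r: "r \<ge> 1"
    and "s \<noteq> []" "length s + m = Suc k"
  shows "window_forecast Q f r k s
    = (lower_transition_operator Q ^^ m) (\<lambda>x. iterated_lower Q f (r - 1) [x]) (last s)"
  using assms(3,4)
proof (induction m arbitrary: s)
  case 0
  then obtain s' x where s: "s = s' @ [x]" "length s' = k"
    by (metis add_0_right append_butlast_last_id diff_Suc_1 length_butlast)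
  have "iterated_lower Q (\<lambda>t. f (take r (drop k t))) (r - 1) s = iterated_lower Q f (r - 1) [x]"
    by (rule iterated_lower_Markov[OF Q]) (use s r in \<open>auto simp: take_Cons'\<close>)
  then show ?case
    using s by (simp add: window_forecast_def)
next
  case (Suc m)
  have tree: "imprecise_probability_tree Q" and Markov: "Q s = Q [last s]"
    using Q Suc.prems(1) unfolding imprecise_Markov_chain_def by blast+
  have "window_forecast Q f r k s = Q s (\<lambda>x. window_forecast Q f r k (s @ [x]))"
    by (rule window_forecast_step[OF tree, symmetric])
  also have "\<dots> = Q s ((lower_transition_operator Q ^^ m) (\<lambda>x. iterated_lower Q f (r - 1) [x]))"
    using Suc.IH Suc.prems(2) by simp
  also have "\<dots> = (lower_transition_operator Q ^^ Suc m)
      (\<lambda>x. iterated_lower Q f (r - 1) [x]) (last s)"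
    unfolding Markov funpow.simps comp_apply by (subst lower_transition_operator_def) simp
  finally show ?case .
qed

lemma sum_late_terms_le:
  assumes C: "0 \<le> (C :: real)"
    and early: "\<And>j. j < n \<Longrightarrow> j + L \<le> n \<Longrightarrow> d j = 0"
    and late: "\<And>j. j < n \<Longrightarrow> \<bar>d j\<bar> \<le> C"
  shows "\<bar>\<Sum>j<n. d j\<bar> \<le> real L * C"
proof -
  have "(\<Sum>j<n. d j) = (\<Sum>j\<in>{n - L..<n}. d j)"
    by (rule sum.mono_neutral_right) (auto intro!: early)
  also have "\<bar>\<dots>\<bar> \<le> (\<Sum>j\<in>{n - L..<n}. \<bar>d j\<bar>)"
    by (rule sum_abs)
  also have "\<dots> \<le> (\<Sum>j\<in>{n - L..<n}. C)"
    by (rule sum_mono) (simp add: late)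
  also have "\<dots> \<le> real L * C"
    using C by (auto intro: mult_right_mono)
  finally show ?thesis .
qed

lemma sum_shift_diff_le:
  fixes a :: "nat \<Rightarrow> real"
  assumes a: "\<And>k. \<bar>a k\<bar> \<le> C"
  shows "\<bar>(\<Sum>j<n. a (j + m)) - (\<Sum>j<n. a j)\<bar> \<le> real m * (2 * C)"
proof (induction m)
  case (Suc m)
  have "(\<Sum>j<n. a (j + Suc m)) - (\<Sum>j<n. a (j + m)) = a (n + m) - a m"
    using sum_lessThan_telescope[of "\<lambda>j. a (j + m)" n] by (simp add: sum_subtractf)
  then have "\<bar>(\<Sum>j<n. a (j + Suc m)) - (\<Sum>j<n. a j)\<bar>
      \<le> \<bar>a (n + m)\<bar> + \<bar>a m\<bar> + \<bar>(\<Sum>j<n. a (j + m)) - (\<Sum>j<n. a j)\<bar>"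
    by linarith
  also have "\<dots> \<le> C + C + real m * (2 * C)"
    by (intro add_mono a Suc.IH)
  also have "\<dots> = real (Suc m) * (2 * C)"
    by (simp add: algebra_simps)
  finally show ?case .
qed simp

text \<open>In the situation \<open>s\<close> of length \<open>n\<close>, sum the forecasts of the windows \<open>m\<close>, \dots,
  \<open>n + m - 1\<close>, each minus \<open>c - \<epsilon>\<close>. In one step of the tree each forecast already present has
  a zero lower expected increment, and the forecast that enters the sum is a value of \<open>T\<^sup>m h\<close>,
  where \<open>T\<close> is the lower transition operator and \<open>c = E_inf T h\<close>; it is at least \<open>c - \<epsilon>\<close> if
  \<open>m\<close> is large. So the sum is a submartingale. It differs by a bounded amount from the sum over the
  windows \<open>0\<close>, \dots, \<open>n - 1\<close> of the values of \<open>f\<close> minus \<open>c - \<epsilon>\<close>, because at most \<open>m + r\<close>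
  of its windows are not yet observed and the two ranges of windows differ by a shift of \<open>m\<close>. The
  second \<open>\<epsilon>\<close> in the statement gives the linear drop that the strong law excludes.\<close>

lemma strictly_null_average_below:
  fixes Q :: "'a::finite tree"
  assumes Q: "imprecise_Markov_chain Q"
    and PF: "Perron_Frobenius_like (lower_transition_operator Q)"
    and r: "r \<ge> 1" and \<epsilon>: "\<epsilon> > 0"
    and c: "c = E_inf (lower_transition_operator Q) (\<lambda>x. iterated_lower Q f (r - 1) [x])"
  shows "strictly_null Q {\<omega>. \<exists>\<^sub>F n in sequentially.
    (\<Sum>k<n. f (Xs (Suc k) r \<omega>)) < real n * (c - 2 * \<epsilon>)}"
proof -
  have tree: "imprecise_probability_tree Q" and E: "lower_expectation (Q s)" for s
    using imprecise_Markov_chain_tree[OF Q] by (simp_all add: imprecise_probability_tree_def)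
  define h where "h = (\<lambda>x. iterated_lower Q f (r - 1) [x])"
  define U where "U = window_forecast Q f r"
  have U_step: "Q s (\<lambda>x. U k (s @ [x])) = U k s" for k s
    by (simp add: U_def window_forecast_step[OF tree])

  have "\<exists>C\<ge>0. \<forall>t::'a list. length t = r \<longrightarrow> \<bar>f t\<bar> \<le> C"
  proof (intro exI conjI allI impI)
    have fin: "finite {t :: 'a list. length t = r}"
      using finite_lists_length_eq[of "UNIV :: 'a set" r] by simp
    show "0 \<le> (\<Sum>t | length t = r. \<bar>f t\<bar>)"
      by (rule sum_nonneg) simp
    show "\<bar>f t\<bar> \<le> (\<Sum>t | length t = r. \<bar>f t\<bar>)" if "length t = r" for t
      by (rule member_le_sum) (use fin that in auto)
  qed
  then obtain C where C: "C \<ge> 0" and f_abs: "\<And>t::'a list. length t = r \<Longrightarrow> \<bar>f t\<bar> \<le> C"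
    by blast
  have U_abs: "\<bar>U k s\<bar> \<le> C" for k s
    unfolding U_def by (rule window_forecast_abs_le[OF tree f_abs])

  have "\<forall>\<^sub>F m in sequentially. \<forall>x. c - \<epsilon> < (lower_transition_operator Q ^^ m) h x"
  proof (rule eventually_all_finite)
    fix x
    have "(\<lambda>m. (lower_transition_operator Q ^^ m) h x) \<longlonglongrightarrow> c"
      using E_inf_limit[OF PF, of h x] unfolding c h_def .
    then show "\<forall>\<^sub>F m in sequentially. c - \<epsilon> < (lower_transition_operator Q ^^ m) h x"
      by (rule order_tendstoD) (use \<epsilon> in simp)
  qed
  then obtain m where m: "\<And>x. c - \<epsilon> < (lower_transition_operator Q ^^ m) h x"
    using eventually_happens'[OF sequentially_bot] by blast
  have U_new: "c - \<epsilon> \<le> U (length s + m) (s @ [x])" for s x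
    using window_forecast_early[OF Q r, of "s @ [x]" m "length s + m" f] m[of x]
    by (simp add: U_def h_def less_imp_le)

  define M where "M s = (\<Sum>j<length s. U (j + m) s - (c - \<epsilon>))" for s
  have M_snoc: "M (s @ [x]) - M s = (\<Sum>j<length s. U (j + m) (s @ [x]) - U (j + m) s)
      + (U (length s + m) (s @ [x]) - (c - \<epsilon>))" for s x
    unfolding M_def by (simp flip: sum_subtractf)
  have "submartingale Q M"
    unfolding submartingale_iff
  proof
    fix s
    have "0 = (\<Sum>j<length s. Q s (\<lambda>x. U (j + m) (s @ [x]) - U (j + m) s))"
      by (simp add: lower_expectation_diff_const[OF E] U_step)
    also have "\<dots> \<le> Q s (\<lambda>x. \<Sum>j<length s. U (j + m) (s @ [x]) - U (j + m) s)"
      by (rule lower_expectation_sum[OF E]) simp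
    also have "\<dots> \<le> Q s (\<lambda>x. M (s @ [x]) - M s)"
      using U_new by (intro lower_expectation_mono[OF E]) (simp add: M_snoc)
    finally show "0 \<le> Q s (\<lambda>x. M (s @ [x]) - M s)" .
  qed
  moreover have "\<bar>M (s @ [x]) - M s\<bar> \<le> real (m + r) * (2 * C) + (C + \<bar>c - \<epsilon>\<bar>)" for s x
  proof -
    have "\<bar>\<Sum>j<length s. U (j + m) (s @ [x]) - U (j + m) s\<bar> \<le> real (m + r) * (2 * C)"
    proof (rule sum_late_terms_le)
      show "U (j + m) (s @ [x]) - U (j + m) s = 0" if "j + (m + r) \<le> length s" for j
        using that by (simp add: U_def window_forecast_observed)
      show "\<bar>U (j + m) (s @ [x]) - U (j + m) s\<bar> \<le> 2 * C" for j
        using U_abs[of "j + m" s] U_abs[of "j + m" "s @ [x]"] by linarith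
    qed (use C in simp)
    then show ?thesis
      unfolding M_snoc using U_abs[of "length s + m" "s @ [x]"] by linarith
  qed
  moreover have "\<epsilon> / 2 > 0" using \<epsilon> by simp
  ultimately have null: "strictly_null Q
      {\<omega>. \<exists>\<^sub>F n in sequentially. M (initial_segment \<omega> n) < M [] - \<epsilon> / 2 * real n}"
    by (rule submartingale_strong_law[OF tree])

  define K where "K = real (m + r) * (2 * C) + real m * (2 * C)"
  have M_le: "M (initial_segment \<omega> n)
      \<le> (\<Sum>k<n. f (Xs (Suc k) r \<omega>)) - real n * (c - \<epsilon>) + K" for \<omega> n
  proof -
    define a where "a k = f (Xs (Suc k) r \<omega>)" for k
    have a_abs: "\<bar>a k\<bar> \<le> C" for k
      unfolding a_def by (rule f_abs) (simp add: Xs_Suc)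
    have "\<bar>\<Sum>j<n. U (j + m) (initial_segment \<omega> n) - a (j + m)\<bar> \<le> real (m + r) * (2 * C)"
    proof (rule sum_late_terms_le)
      show "U (j + m) (initial_segment \<omega> n) - a (j + m) = 0" if "j + (m + r) \<le> n" for j
        using that by (simp add: U_def window_forecast_observed a_def Xs_Suc
            initial_segment_eq_map drop_map take_map)
      show "\<bar>U (j + m) (initial_segment \<omega> n) - a (j + m)\<bar> \<le> 2 * C" for j
        using U_abs[of "j + m" "initial_segment \<omega> n"] a_abs[of "j + m"] by linarith
    qed (use C in simp)
    moreover have "\<bar>(\<Sum>j<n. a (j + m)) - (\<Sum>j<n. a j)\<bar> \<le> real m * (2 * C)"
      by (rule sum_shift_diff_le[OF a_abs])
    moreover have "M (initial_segment \<omega> n)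
        = (\<Sum>j<n. U (j + m) (initial_segment \<omega> n)) - real n * (c - \<epsilon>)"
      by (simp add: M_def sum_subtractf)
    ultimately show ?thesis
      by (simp add: sum_subtractf K_def flip: a_def)
  qed
  show ?thesis
  proof (rule strictly_null_subset[OF null], clarify)
    fix \<omega>
    assume "\<exists>\<^sub>F n in sequentially. (\<Sum>k<n. f (Xs (Suc k) r \<omega>)) < real n * (c - 2 * \<epsilon>)"
    moreover have "\<forall>\<^sub>F n in sequentially. 2 * K / \<epsilon> \<le> real n"
      by (rule eventually_sequentiallyI[of "nat \<lceil>2 * K / \<epsilon>\<rceil>"]) linarith
    ultimately have "\<exists>\<^sub>F n in sequentially.
        2 * K / \<epsilon> \<le> real n \<and> (\<Sum>k<n. f (Xs (Suc k) r \<omega>)) < real n * (c - 2 * \<epsilon>)"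
      by (rule frequently_eventually_conj)
    then show "\<exists>\<^sub>F n in sequentially. M (initial_segment \<omega> n) < M [] - \<epsilon> / 2 * real n"
    proof (rule frequently_elim1, clarify)
      fix n
      assume low: "(\<Sum>k<n. f (Xs (Suc k) r \<omega>)) < real n * (c - 2 * \<epsilon>)"
        and "2 * K / \<epsilon> \<le> real n"
      then have "K \<le> \<epsilon> / 2 * real n"
        using \<epsilon> by (simp add: field_simps)
      moreover have "real n * (c - 2 * \<epsilon>) - real n * (c - \<epsilon>) = - (\<epsilon> / 2 * real n) - \<epsilon> / 2 * real n"
        by (simp add: algebra_simps)
      ultimately have "M (initial_segment \<omega> n) < - (\<epsilon> / 2 * real n)"
        using low M_le[of \<omega> n] by linarith
      then show "M (initial_segment \<omega> n) < M [] - \<epsilon> / 2 * real n"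
        by (simp add: M_def)
    qed
  qed
qed

section \<open>The ergodic bound\<close>

theorem corollary33:
  fixes Q :: "'a::finite tree" and E1 :: "('a \<Rightarrow> real) \<Rightarrow> real"
    and T :: "('a \<Rightarrow> real) \<Rightarrow> ('a \<Rightarrow> real)"
    and r :: nat and f :: "'a list \<Rightarrow> real"
  assumes "imprecise_Markov_chain Q"
    and "marginal_model Q = E1"
    and "lower_transition_operator Q = T"
    and "Perron_Frobenius_like T"
    and "r \<ge> 1"
  shows "strictly_almost_surely Q (\<lambda>\<omega>.
           liminf (\<lambda>n. ereal ((1 / real n) * (\<Sum>k=1..n. f (Xs k r \<omega>))))
             \<ge> global_lower_expectation (stationary_chain Q) (\<lambda>\<omega>'. f (Xs 1 r \<omega>')))"
proof -
  define c where
    "c = E_inf (lower_transition_operator Q) (\<lambda>x. iterated_lower Q f (r - 1) [x])"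
  have PF: "Perron_Frobenius_like (lower_transition_operator Q)"
    using assms(3,4) by simp
  have tree: "imprecise_probability_tree Q"
    by (rule imprecise_Markov_chain_tree[OF assms(1)])
  define A where "A j = {\<omega>. \<exists>\<^sub>F n in sequentially.
    (\<Sum>k<n. f (Xs (Suc k) r \<omega>)) < real n * (c - 2 * inverse (real (Suc j)))}" for j
  have "strictly_null Q (A j)" for j
    unfolding A_def
    by (rule strictly_null_average_below[OF assms(1) PF assms(5) _ c_def]) simp
  then have null: "strictly_null Q (\<Union>j. A j)"
    by (rule strictly_null_countable_UN[OF tree])
  have global_le: "global_lower_expectation (stationary_chain Q) (\<lambda>\<omega>'. f (Xs 1 r \<omega>')) \<le> ereal c"
    unfolding c_def
    by (rule global_lower_expectation_stationary_chain_le[OF assms(1) PF assms(5)])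
  show ?thesis
    unfolding strictly_almost_surely_def
  proof (rule strictly_null_subset[OF null], clarify)
    fix \<omega>
    define avg where "avg n = (1 / real n) * (\<Sum>k=1..n. f (Xs k r \<omega>))" for n
    assume "\<not> global_lower_expectation (stationary_chain Q) (\<lambda>\<omega>'. f (Xs 1 r \<omega>'))
      \<le> liminf (\<lambda>n. ereal ((1 / real n) * (\<Sum>k=1..n. f (Xs k r \<omega>))))"
    then have "liminf (\<lambda>n. ereal (avg n)) < ereal c"
      using global_le unfolding avg_def by (meson not_le order_less_le_trans)
    then obtain d where d: "liminf (\<lambda>n. ereal (avg n)) < ereal d" "d < c"
      using ereal_dense2[of "liminf (\<lambda>n. ereal (avg n))" "ereal c"] by auto
    have freq: "\<exists>\<^sub>F n in sequentially. avg n < d"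
    proof (rule ccontr)
      assume "\<not> ?thesis"
      then have "\<forall>\<^sub>F n in sequentially. ereal d \<le> ereal (avg n)"
        by (simp add: not_frequently not_less)
      then have "ereal d \<le> liminf (\<lambda>n. ereal (avg n))"
        by (rule Liminf_bounded)
      with d(1) show False by simp
    qed
    obtain j where j: "inverse (real (Suc j)) < (c - d) / 2"
      using reals_Archimedean[of "(c - d) / 2"] d(2) by auto
    have "\<exists>\<^sub>F n in sequentially. 1 \<le> n \<and> avg n < d"
      by (rule frequently_eventually_conj[OF freq eventually_ge_at_top])
    then have "\<omega> \<in> A j"
      unfolding A_def mem_Collect_eq
    proof (rule frequently_elim1, clarify)
      fix n :: nat
      assume n: "1 \<le> n" and avg: "avg n < d"
      have "(\<Sum>k<n. f (Xs (Suc k) r \<omega>)) = real n * avg n"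
        using n by (simp add: avg_def sum.atLeast1_atMost_eq)
      also have "\<dots> < real n * (c - 2 * inverse (real (Suc j)))"
        using avg n j by (intro mult_strict_left_mono) auto
      finally show "(\<Sum>k<n. f (Xs (Suc k) r \<omega>))
          < real n * (c - 2 * inverse (real (Suc j)))" .
    qed
    then show "\<omega> \<in> (\<Union>j. A j)" by blast
  qed
qed

end
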